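(* Let $q\ge 3$ be a prime such that $p=\frac{q-1}{2}$ is odd. Then the minimum order $n\!\left[\frac{p+1}{2},q;6\right]$ of a $\left[\frac{p+1}{2},q;6\right]$-mixed graph satisfies $$n\!\left[\tfrac{p+1}{2},\,q;\,6\right]\le 4q^2 .$$
   Context: A mixed graph $G=(V;E\cup A)$ has a finite vertex set $V$, a set $E$ of (undirected) edges $uv$ and a set $A$ of arcs $(u,v)$; it is simple: no parallel arcs, no parallel edges, and no arc parallel to an edge. Walks, paths and cycles are sequences of vertices in which each consecutive pair $v_i,v_{i+1}$ is joined by the arc $(v_i,v_{i+1})$ or by the edge $v_iv_{i+1}$ (arcs are traversed in their direction, edges in either direction; a cycle is closed, has no repeated vertices, and traversing a single edge back and forth is not a cycle). The girth is the length of a shortest cycle. A $[z,r;g]$-mixed graph is a mixed graph in which every vertex has exactly $z$ in-arcs, $z$ out-arcs and $r$ edges, and whose girth is $g$. The order of a graph is its number of vertices; $n[z,r;g]$ denotes the minimum order of a $[z,r;g]$-mixed graph, and a $[z,r;g]$-mixed cage is a $[z,r;g]$-mixed graph of that order. *)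

theory Defs
  imports "HOL-Computational_Algebra.Primes" "HOL-Library.Extended_Nat"
begin

record 'a mixed_graph =
  verts :: "'a set"
  edges :: "'a set set"
  arcs :: "('a \<times> 'a) set"

text \<open>
  Edges are two-element sets and arcs are ordered pairs, so parallel edges and parallel arcs
  cannot occur. Loops are excluded, as usual for simple graphs. Two opposite arcs
  (u, v) and (v, u) are allowed here; they form a cycle of length 2.
\<close>

definition simple_mixed_graph :: "'a mixed_graph \<Rightarrow> bool" where
  "simple_mixed_graph G \<longleftrightarrow>
     finite (verts G) \<and>
     (\<forall>e\<in>edges G. e \<subseteq> verts G \<and> card e = 2) \<and>
     (\<forall>(u, v)\<in>arcs G. u \<in> verts G \<and> v \<in> verts G \<and> u \<noteq> v \<and> {u, v} \<notin> edges G)"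

definition step :: "'a mixed_graph \<Rightarrow> 'a \<Rightarrow> 'a \<Rightarrow> bool" where
  "step G u v \<longleftrightarrow> (u, v) \<in> arcs G \<or> {u, v} \<in> edges G"

text \<open>
  A cycle is given by the list of its distinct vertices, without repeating the first one at the
  end; its length is the length of the list. The last conjunct says that a closed walk of length 2
  uses at least one arc, i.e. that it does not traverse a single edge back and forth.
\<close>

definition is_cycle :: "'a mixed_graph \<Rightarrow> 'a list \<Rightarrow> bool" where
  "is_cycle G vs \<longleftrightarrow>
     vs \<noteq> [] \<and> distinct vs \<and> set vs \<subseteq> verts G \<and>
     (\<forall>i<length vs. step G (vs ! i) (vs ! (Suc i mod length vs))) \<and>
     (length vs = 2 \<longrightarrow> (vs ! 0, vs ! 1) \<in> arcs G \<or> (vs ! 1, vs ! 0) \<in> arcs G)"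

text \<open>The infimum of the empty set is \<open>\<infinity>\<close>, so an acyclic graph has girth \<open>\<infinity>\<close>.\<close>

definition girth :: "'a mixed_graph \<Rightarrow> enat" where
  "girth G = Inf {enat (length vs) | vs. is_cycle G vs}"

definition zrg_mixed_graph :: "nat \<Rightarrow> nat \<Rightarrow> nat \<Rightarrow> 'a mixed_graph \<Rightarrow> bool" where
  "zrg_mixed_graph z r g G \<longleftrightarrow>
     simple_mixed_graph G \<and>
     (\<forall>v\<in>verts G.
        card {a \<in> arcs G. snd a = v} = z \<and>
        card {a \<in> arcs G. fst a = v} = z \<and>
        card {e \<in> edges G. v \<in> e} = r) \<and>
     girth G = enat g"

text \<open>
  Every finite graph is isomorphic to one whose vertices are natural numbers, so it suffices to
  minimise over those. The value is \<open>\<infinity>\<close> if no such graph exists; in particular a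
  finite upper bound includes the existence of a graph attaining the minimum.
\<close>

definition min_order :: "nat \<Rightarrow> nat \<Rightarrow> nat \<Rightarrow> enat" where
  "min_order z r g =
     Inf {enat (card (verts G)) | G :: nat mixed_graph. zrg_mixed_graph z r g G}"

end

theory Submission
  imports Defs "HOL-Library.Countable"
begin

text \<open>
  The graph consists of two copies of the incidence graph of the biaffine plane over the field
  with \<open>q\<close> elements, where the point \<open>(x, y)\<close> and the line \<open>(m, b)\<close> are incident iff
  \<open>y + b = x m\<close>: it is \<open>q\<close>-regular of girth 6, it has \<open>2 q\<^sup>2\<close> vertices, and vertices with
  equal first coordinate never have a common neighbour. The arcs lead from one copy to the other,
  keep the kind (point or line) and the first coordinate of the vertex and add to the second
  coordinate an element of \<open>S\<close> (from copy 0 to copy 1) or of \<open>T\<close> (from copy 1 to copy 0). Each step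
  changes exactly one of kind and copy, so the graph is bipartite, and the remaining short cycles are
  excluded if 0 lies in none of \<open>S + T\<close>, \<open>S + S + T + T\<close> and \<open>S - T\<close>. The second
  condition says that \<open>S + S\<close> and \<open>-(T + T)\<close> are disjoint; arithmetic progressions of length
  \<open>h = (p + 1) / 2\<close> have sumsets of size \<open>p\<close>, so they just fit into the \<open>q = 2 p + 1\<close> residues.
\<close>

subsection \<open>Relabelling the vertices\<close>

text \<open>Since \<open>min_order\<close> ranges over graphs on natural numbers, a graph built on
  tuples has to be transported there.\<close>

definition relabel :: "('a \<Rightarrow> 'b) \<Rightarrow> 'a mixed_graph \<Rightarrow> 'b mixed_graph" where
  "relabel f G = \<lparr>verts = f ` verts G, edges = image f ` edges G, arcs = map_prod f f ` arcs G\<rparr>"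

lemma relabel_sel [simp]:
  "verts (relabel f G) = f ` verts G"
  "edges (relabel f G) = image f ` edges G"
  "arcs (relabel f G) = map_prod f f ` arcs G"
  by (simp_all add: relabel_def)

lemma arc_relabel_iff:
  assumes "inj f"
  shows "(f u, f v) \<in> arcs (relabel f G) \<longleftrightarrow> (u, v) \<in> arcs G"
  using assms by (auto simp: inj_eq image_iff map_prod_def split: prod.splits)

lemma edge_relabel_iff:
  assumes "inj f"
  shows "{f u, f v} \<in> edges (relabel f G) \<longleftrightarrow> {u, v} \<in> edges G"
proof -
  have "inj (image f)"
    by (rule injI) (simp only: inj_image_eq_iff[OF assms])
  then have "f ` {u, v} \<in> image f ` edges G \<longleftrightarrow> {u, v} \<in> edges G"
    by (rule inj_image_mem_iff)
  then show ?thesis by simp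
qed

lemma step_relabel_iff:
  assumes "inj f"
  shows "step (relabel f G) (f u) (f v) \<longleftrightarrow> step G u v"
  unfolding step_def arc_relabel_iff[OF assms] edge_relabel_iff[OF assms] ..

lemma is_cycle_relabel_map_iff:
  assumes "inj f"
  shows "is_cycle (relabel f G) (map f vs) \<longleftrightarrow> is_cycle G vs"
proof -
  have steps: "(\<forall>i<length vs. step (relabel f G) (map f vs ! i) (map f vs ! (Suc i mod length vs)))
    \<longleftrightarrow> (\<forall>i<length vs. step G (vs ! i) (vs ! (Suc i mod length vs)))"
  proof (intro all_cong)
    fix i assume i: "i < length vs"
    \<comment> \<open>The cyclic successor stays a valid index, so \<open>nth_map\<close> applies to
      it as well.\<close>
    then have "Suc i mod length vs < length vs" by (intro mod_less_divisor) auto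
    with i show "step (relabel f G) (map f vs ! i) (map f vs ! (Suc i mod length vs)) \<longleftrightarrow>
      step G (vs ! i) (vs ! (Suc i mod length vs))"
      by (simp only: nth_map step_relabel_iff[OF assms])
  qed
  have len2: "(length vs = 2 \<longrightarrow> (map f vs ! 0, map f vs ! 1) \<in> arcs (relabel f G)
      \<or> (map f vs ! 1, map f vs ! 0) \<in> arcs (relabel f G)) \<longleftrightarrow>
    (length vs = 2 \<longrightarrow> (vs ! 0, vs ! 1) \<in> arcs G \<or> (vs ! 1, vs ! 0) \<in> arcs G)"
    by (intro imp_cong refl) (simp del: relabel_sel add: arc_relabel_iff[OF assms])
  have verts: "set (map f vs) \<subseteq> verts (relabel f G) \<longleftrightarrow> set vs \<subseteq> verts G"
    using assms by (simp add: inj_image_subset_iff)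
  have distinct: "distinct (map f vs) \<longleftrightarrow> distinct vs"
    using inj_on_subset[OF assms subset_UNIV, of "set vs"] by (simp add: distinct_map)
  show ?thesis
    unfolding is_cycle_def length_map map_is_Nil_conv steps len2 verts distinct ..
qed

lemma girth_relabel:
  assumes "inj f"
  shows "girth (relabel f G) = girth G"
proof -
  \<comment> \<open>No cycles are added: all vertices of the new graph lie in the range of
    \<open>f\<close>, so \<open>inv f\<close> pulls a cycle back.\<close>
  have "\<exists>ws. vs = map f ws" if "is_cycle (relabel f G) vs" for vs
  proof -
    have "set vs \<subseteq> range f" using that by (auto simp: is_cycle_def)
    then have "map f (map (inv f) vs) = vs"
      by (auto simp: f_inv_into_f intro!: map_idI)
    then show ?thesis by metis
  qed
  then have "(\<exists>vs. n = enat (length vs) \<and> is_cycle (relabel f G) vs) \<longleftrightarrow>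
      (\<exists>vs. n = enat (length vs) \<and> is_cycle G vs)" for n
    using is_cycle_relabel_map_iff[OF assms, of G] by (metis length_map)
  then show ?thesis by (simp add: girth_def)
qed

lemma zrg_mixed_graph_relabel:
  assumes "inj f" and G: "zrg_mixed_graph z r g G"
  shows "zrg_mixed_graph z r g (relabel f G)"
proof -
  have simple: "simple_mixed_graph G" using G by (simp add: zrg_mixed_graph_def)
  have inj: "inj_on f S" for S using assms(1) by (rule inj_on_subset) simp
  have inj2: "inj_on (map_prod f f) S" for S
    using map_prod_inj_on[OF assms(1) assms(1)] by (rule inj_on_subset) simp
  have injI: "inj_on (image f) S" for S
    using assms(1) by (auto simp: inj_on_def inj_image_eq_iff)
  have "simple_mixed_graph (relabel f G)"
    unfolding simple_mixed_graph_def
  proof (intro conjI ballI)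
    show "finite (verts (relabel f G))" using simple by (simp add: simple_mixed_graph_def)
  next
    fix e assume "e \<in> edges (relabel f G)"
    then show "e \<subseteq> verts (relabel f G)" "card e = 2"
      using simple by (auto simp: simple_mixed_graph_def card_image[OF inj] dest: bspec)
  next
    fix a assume "a \<in> arcs (relabel f G)"
    then obtain u v where a: "a = (f u, f v)" and uv: "(u, v) \<in> arcs G" by auto
    then have "u \<in> verts G" "v \<in> verts G" "u \<noteq> v" "{u, v} \<notin> edges G"
      using simple by (auto simp: simple_mixed_graph_def)
    then show "case a of (u, v) \<Rightarrow> u \<in> verts (relabel f G) \<and> v \<in> verts (relabel f G) \<and> u \<noteq> v
        \<and> {u, v} \<notin> edges (relabel f G)"
      unfolding a using edge_relabel_iff[OF assms(1), of u v G] assms(1)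
      by (simp del: relabel_sel(2) add: inj_eq)
  qed
  moreover have "card {a \<in> arcs (relabel f G). snd a = f v} = card {a \<in> arcs G. snd a = v}"
    "card {a \<in> arcs (relabel f G). fst a = f v} = card {a \<in> arcs G. fst a = v}"
    "card {e \<in> edges (relabel f G). f v \<in> e} = card {e \<in> edges G. v \<in> e}" for v
  proof -
    have "{a \<in> arcs (relabel f G). snd a = f v} = map_prod f f ` {a \<in> arcs G. snd a = v}"
      "{a \<in> arcs (relabel f G). fst a = f v} = map_prod f f ` {a \<in> arcs G. fst a = v}"
      using assms(1) by (auto simp: inj_eq)
    moreover have "{e \<in> edges (relabel f G). f v \<in> e} = image f ` {e \<in> edges G. v \<in> e}"
      using inj_image_mem_iff[OF assms(1)] by auto
    ultimately show "card {a \<in> arcs (relabel f G). snd a = f v} = card {a \<in> arcs G. snd a = v}"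
      "card {a \<in> arcs (relabel f G). fst a = f v} = card {a \<in> arcs G. fst a = v}"
      "card {e \<in> edges (relabel f G). f v \<in> e} = card {e \<in> edges G. v \<in> e}"
      by (simp_all only: card_image[OF inj2] card_image[OF injI])
  qed
  ultimately show ?thesis
    using G girth_relabel[OF assms(1), of G] unfolding zrg_mixed_graph_def
    by (simp only: relabel_sel(1) ball_simps) auto
qed

lemma min_order_le:
  fixes G :: "'a::countable mixed_graph"
  assumes "zrg_mixed_graph z r g G"
  shows "min_order z r g \<le> enat (card (verts G))"
proof -
  let ?f = "to_nat :: 'a \<Rightarrow> nat"
  have "zrg_mixed_graph z r g (relabel ?f G)"
    using assms by (intro zrg_mixed_graph_relabel) simp_all
  moreover have "card (verts (relabel ?f G)) = card (verts G)"
    by (simp add: card_image)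
  ultimately show ?thesis
    unfolding min_order_def by (metis (mono_tags, lifting) Inf_lower mem_Collect_eq)
qed

subsection \<open>Two copies of the biaffine plane\<close>

text \<open>
  In a vertex \<open>(s, c, x, y)\<close>, the component \<open>s\<close> tells points from lines and \<open>c\<close> is the copy.
\<close>

type_synonym vertex = "bool \<times> bool \<times> int \<times> int"

lemma dvd_imp_eq_0:
  fixes q a :: int
  assumes "q dvd a" "\<bar>a\<bar> < q"
  shows "a = 0"
  using assms dvd_imp_le_int[of a q] by linarith

lemma mod_unique_residue:
  fixes q a b :: int
  assumes "0 \<le> a" "a < q" "q dvd a - b"
  shows "a = b mod q"
  using assms mod_pos_pos_trivial[of a q] by (simp flip: mod_eq_dvd_iff)

text \<open>Here \<open>h\<close> plays the role of (p + 1) / 2, so q = 2 p + 1 becomes 4 h - 1.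
  Integers allow negative shifts and genuine subtraction.\<close>

locale biaffine =
  fixes h q :: int
  assumes q_def: "q = 4 * h - 1" and prime_q: "prime q"
begin

text \<open>The set is indexed by the copy in which the arc starts. Adding one shift of each kind
  gives a value from 1 to 2 h - 1, so two such sums give at most 4 h - 2 = q - 1, just short of a
  multiple of q.\<close>

definition shifts :: "bool \<Rightarrow> int set" where
  "shifts c = (if c then {1 - h..0} else {h..2 * h - 1})"

definition V :: "vertex set" where
  "V = UNIV \<times> UNIV \<times> {0..<q} \<times> {0..<q}"

text \<open>Congruences are written as divisibilities so that those along a closed walk can simply
  be added and subtracted.\<close>

definition A :: "(vertex \<times> vertex) set" where
  "A = {((s, c, x, y), (s, \<not> c, x, z)) | s c x y z d.
     x \<in> {0..<q} \<and> y \<in> {0..<q} \<and> z \<in> {0..<q} \<and> d \<in> shifts c \<and> q dvd z - y - d}"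

text \<open>The incidence equation is symmetric in point and line, so neither kind needs separate
  treatment.\<close>

definition adj :: "vertex \<Rightarrow> vertex \<Rightarrow> bool" where
  "adj u v \<longleftrightarrow> u \<in> V \<and> v \<in> V \<and> (\<exists>s c x y m b. u = (s, c, x, y) \<and> v = (\<not> s, c, m, b) \<and> q dvd y + b - x * m)"

definition G :: "vertex mixed_graph" where
  "G = \<lparr>verts = V, edges = {{u, v} | u v. adj u v}, arcs = A\<rparr>"

lemma G_sel [simp]: "verts G = V" "edges G = {{u, v} | u v. adj u v}" "arcs G = A"
  by (simp_all add: G_def)

lemma h_pos: "h \<ge> 1"
  using q_def prime_gt_1_int[OF prime_q] by simp

lemma q_ge_3: "q \<ge> 3"
  using q_def h_pos by simp

lemma adj_sym: "adj u v \<Longrightarrow> adj v u"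
  unfolding adj_def by (auto simp: algebra_simps)

lemma edge_iff_adj: "{u, v} \<in> edges G \<longleftrightarrow> adj u v"
proof
  assume "{u, v} \<in> edges G"
  then obtain u' v' where uv: "{u, v} = {u', v'}" "adj u' v'" unfolding G_sel by blast
  from uv(1) have "u = u' \<and> v = v' \<or> u = v' \<and> v = u'" by (simp only: doubleton_eq_iff)
  then show "adj u v" using uv(2) adj_sym by blast
next
  assume "adj u v"
  then show "{u, v} \<in> edges G" unfolding G_sel by blast
qed

lemma step_iff: "step G u v \<longleftrightarrow> (u, v) \<in> A \<or> adj u v"
  by (simp add: step_def edge_iff_adj del: G_sel(2))

lemma arcE:
  assumes "(u, v) \<in> A"
  obtains s c x y z d where "u = (s, c, x, y)" "v = (s, \<not> c, x, z)"
    "x \<in> {0..<q}" "y \<in> {0..<q}" "z \<in> {0..<q}" "d \<in> shifts c" "q dvd z - y - d"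
  using assms unfolding A_def by blast

lemma adjE:
  assumes "adj u v"
  obtains s c x y m b where "u = (s, c, x, y)" "v = (\<not> s, c, m, b)"
    "x \<in> {0..<q}" "y \<in> {0..<q}" "m \<in> {0..<q}" "b \<in> {0..<q}" "q dvd y + b - x * m"
  using assms unfolding adj_def V_def by auto

lemma residue_eqI:
  assumes "x \<in> {0..<q}" "y \<in> {0..<q}" "q dvd x - y"
  shows "x = y"
  using assms dvd_imp_eq_0[of q "x - y"] by auto

lemma not_dvd_if_bounds: "0 < a \<Longrightarrow> a < q \<Longrightarrow> \<not> q dvd a"
  by (simp add: zdvd_not_zless)

section \<open>Closed walks of lengths 2 and 4\<close>

lemma shifts_sum_bounds:
  assumes "d \<in> shifts c" "d' \<in> shifts (\<not> c)"
  shows "0 < d + d'" "2 * (d + d') < q"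
  using assms q_def h_pos by (auto simp: shifts_def split: if_splits)

lemma shifts_disjoint_mod:
  assumes "d \<in> shifts c" "d' \<in> shifts (\<not> c)"
  shows "\<not> q dvd d - d'"
proof
  assume "q dvd d - d'"
  moreover have "\<bar>d - d'\<bar> < q" "d \<noteq> d'"
    using assms q_def h_pos by (auto simp: shifts_def split: if_splits)
  ultimately show False using dvd_imp_eq_0[of q "d - d'"] by simp
qed

lemma no_arc_arc_2cycle:
  assumes "(u, v) \<in> A" "(v, u) \<in> A"
  shows False
proof -
  from assms(1) obtain s c x y z d where 1: "u = (s, c, x, y)" "v = (s, \<not> c, x, z)"
    "d \<in> shifts c" "q dvd z - y - d" by (rule arcE)
  from assms(2) 1 obtain d' where 2: "d' \<in> shifts (\<not> c)" "q dvd y - z - d'"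
    by (auto elim!: arcE)
  have "q dvd d + d'" using dvd_add[OF 1(4) 2(2)] dvd_minus_iff[of q "d + d'"] by (simp add: algebra_simps)
  then show False using not_dvd_if_bounds shifts_sum_bounds[OF 1(3) 2(1)] by force
qed

text \<open>Copies alternate along arcs, so the total shift is a sum of two shifts of each kind. It
  would have to vanish mod q but lies strictly between 0 and q.\<close>

lemma no_arc_4cycle:
  assumes "(t, u) \<in> A" "(u, v) \<in> A" "(v, w) \<in> A" "(w, t) \<in> A"
  shows False
proof -
  from assms(1) obtain s c x y0 y1 d0 where 0: "t = (s, c, x, y0)" "u = (s, \<not> c, x, y1)"
    "d0 \<in> shifts c" "q dvd y1 - y0 - d0" by (rule arcE)
  from assms(2) 0 obtain y2 d1 where 1: "v = (s, c, x, y2)" "d1 \<in> shifts (\<not> c)" "q dvd y2 - y1 - d1"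
    by (auto elim!: arcE)
  from assms(3) 1 obtain y3 d2 where 2: "w = (s, \<not> c, x, y3)" "d2 \<in> shifts c" "q dvd y3 - y2 - d2"
    by (auto elim!: arcE)
  from assms(4) 0 2 obtain d3 where 3: "d3 \<in> shifts (\<not> c)" "q dvd y0 - y3 - d3"
    by (auto elim!: arcE)
  have "q dvd - (d0 + d1 + (d2 + d3))"
    using dvd_add[OF dvd_add[OF 0(4) 1(3)] dvd_add[OF 2(3) 3(2)]] by (simp add: algebra_simps)
  then have "q dvd d0 + d1 + (d2 + d3)" by (simp only: dvd_minus_iff)
  moreover have "0 < d0 + d1 + (d2 + d3)" "d0 + d1 + (d2 + d3) < q"
    using shifts_sum_bounds[OF 0(3) 1(2)] shifts_sum_bounds[OF 2(2) 3(1)] by simp_all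
  ultimately show False using not_dvd_if_bounds by blast
qed

text \<open>Two arcs lead back to the same copy, kind and first coordinate. The common neighbour
  \<open>w\<close> then determines the second coordinate.\<close>

lemma arc_arc_edge_edge:
  assumes "(t, u) \<in> A" "(u, v) \<in> A" "adj v w" "adj w t"
  shows "t = v"
proof -
  from assms(1,2) obtain s c x y z where 1: "t = (s, c, x, y)" "v = (s, c, x, z)"
    "y \<in> {0..<q}" "z \<in> {0..<q}" by (auto elim!: arcE)
  from assms(3) 1 obtain m b where 2: "w = (\<not> s, c, m, b)" "q dvd z + b - x * m"
    by (auto elim!: adjE)
  from assms(4) 1 2 have 3: "q dvd b + y - m * x" by (auto elim!: adjE)
  have "q dvd y - z" using dvd_diff[OF 3 2(2)] by (simp add: algebra_simps)
  then show ?thesis using 1 residue_eqI by simp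
qed

text \<open>Both edges join the first coordinates \<open>x\<close> and \<open>m\<close>, so the sum
  of second coordinates is the same on both. The two arcs therefore shift by congruent amounts,
  although one shift comes from each set.\<close>

lemma no_arc_edge_arc_edge:
  assumes "(t, u) \<in> A" "adj u v" "(v, w) \<in> A" "adj w t"
  shows False
proof -
  from assms(1) obtain s c x y0 y1 d where 0: "t = (s, c, x, y0)" "u = (s, \<not> c, x, y1)"
    "d \<in> shifts c" "q dvd y1 - y0 - d" by (rule arcE)
  from assms(2) 0 obtain m b where 1: "v = (\<not> s, \<not> c, m, b)" "q dvd y1 + b - x * m"
    by (auto elim!: adjE)
  from assms(3) 1 obtain b' d' where 2: "w = (\<not> s, c, m, b')" "d' \<in> shifts (\<not> c)" "q dvd b' - b - d'"
    by (auto elim!: arcE)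
  from assms(4) 0 2 have 3: "q dvd b' + y0 - m * x" by (auto elim!: adjE)
  have "q dvd d - d'"
    using dvd_add[OF dvd_diff[OF 1(2) 3] dvd_diff[OF 2(3) 0(4)]] by (simp add: algebra_simps)
  then show False using shifts_disjoint_mod[OF 0(3) 2(2)] by blast
qed

text \<open>The biaffine plane has no quadrilaterals: two points have at most one common
  line.\<close>

lemma edge_4walk:
  assumes "adj t u" "adj u v" "adj v w" "adj w t"
  shows "t = v \<or> u = w"
proof -
  from assms(1) obtain s c x0 y0 x1 y1 where 0: "t = (s, c, x0, y0)" "u = (\<not> s, c, x1, y1)"
    "q dvd y0 + y1 - x0 * x1" and r: "x0 \<in> {0..<q}" "y0 \<in> {0..<q}" "x1 \<in> {0..<q}" "y1 \<in> {0..<q}"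
    by (rule adjE)
  from assms(2) 0 obtain x2 y2 where 1: "v = (s, c, x2, y2)" "q dvd y1 + y2 - x1 * x2"
    and r2: "x2 \<in> {0..<q}" "y2 \<in> {0..<q}"
    by (auto elim!: adjE)
  from assms(3) 1 obtain x3 y3 where 2: "w = (\<not> s, c, x3, y3)" "q dvd y2 + y3 - x2 * x3"
    and r3: "x3 \<in> {0..<q}" "y3 \<in> {0..<q}"
    by (auto elim!: adjE)
  from assms(4) 0 2 have 3: "q dvd y3 + y0 - x3 * x0" by (auto elim!: adjE)
  \<comment> \<open>In the alternating sum of the four incidences the second coordinates cancel and
    the products factor; primality of \<open>q\<close> then makes two opposite first coordinates
    equal.\<close>
  have "q dvd (x0 - x2) * (x3 - x1)"
    using dvd_add[OF dvd_diff[OF 0(3) 1(2)] dvd_diff[OF 2(2) 3]] by (simp add: algebra_simps)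
  then consider (tv) "q dvd x0 - x2" | (uw) "q dvd x3 - x1"
    using prime_q by (auto simp: prime_dvd_mult_iff)
  then show ?thesis
  proof cases
    case tv
    then have "x0 = x2" using residue_eqI r r2 by blast
    moreover from this have "q dvd y0 - y2" using dvd_diff[OF 0(3) 1(2)] by (simp add: algebra_simps)
    ultimately show ?thesis using 0 1 residue_eqI r r2 by blast
  next
    case uw
    then have "x3 = x1" using residue_eqI r r3 by blast
    moreover from this have "q dvd y1 - y3" using dvd_diff[OF 1(2) 2(2)] by (simp add: algebra_simps)
    ultimately show ?thesis using 0 2 residue_eqI r r3 by blast
  qed
qed

section \<open>Parity invariants and the girth\<close>

definition colour :: "vertex \<Rightarrow> bool" where
  "colour v \<longleftrightarrow> (fst v \<longleftrightarrow> fst (snd v))"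

text \<open>A step flips exactly one of kind and copy, hence also whether they agree. This
  2-colouring rules out closed walks of odd length.\<close>

lemma step_colour: "step G u v \<Longrightarrow> colour v \<longleftrightarrow> \<not> colour u"
  by (auto elim!: arcE adjE simp: step_iff colour_def)

text \<open>Arcs preserve this invariant and edges flip it, so arcs are never parallel to edges and
  a closed walk has an even number of edges.\<close>

definition kind :: "vertex \<Rightarrow> bool" where
  "kind v = fst v"

lemma arc_kind: "(u, v) \<in> A \<Longrightarrow> kind v = kind u"
  by (auto elim!: arcE simp: kind_def)

lemma adj_kind: "adj u v \<Longrightarrow> kind v = (\<not> kind u)"
  by (auto elim!: adjE simp: kind_def)

text \<open>By parity of the kind there are 0, 2 or 4 edges. Two edges are either consecutive (four
  rotations) or alternate with the arcs (two rotations).\<close>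

lemma step_4walk:
  assumes "step G t u" "step G u v" "step G v w" "step G w t"
  shows "t = v \<or> u = w"
  using assms arc_kind[of t u] arc_kind[of u v] arc_kind[of v w] arc_kind[of w t]
    adj_kind[of t u] adj_kind[of u v] adj_kind[of v w] adj_kind[of w t]
    no_arc_4cycle[of t u v w] edge_4walk[of t u v w]
    arc_arc_edge_edge[of t u v w] arc_arc_edge_edge[of u v w t]
    arc_arc_edge_edge[of v w t u] arc_arc_edge_edge[of w t u v]
    no_arc_edge_arc_edge[of t u v w] no_arc_edge_arc_edge[of u v w t]
  unfolding step_iff by argo

lemma cycle_length_ge_6:
  assumes "is_cycle G vs"
  shows "length vs \<ge> 6"
proof (rule ccontr)
  assume "\<not> length vs \<ge> 6"
  moreover have "length vs \<noteq> 0" using assms by (simp add: is_cycle_def)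
  ultimately consider "length vs = 1" | "length vs = 2" | "length vs = 3" | "length vs = 4" | "length vs = 5"
    by linarith
  moreover have st: "step G (vs ! i) (vs ! j)" if "i < length vs" "j = (i + 1) mod length vs" for i j
    using assms that by (simp add: is_cycle_def)
  moreover have dist: "distinct vs" using assms by (simp add: is_cycle_def)
  ultimately show False
  proof cases
    case 1
    then have "step G (vs ! 0) (vs ! 0)" by (intro st) simp_all
    then show False using step_colour by blast
  next
    case 2
    then have s: "step G (vs ! 0) (vs ! 1)" "step G (vs ! 1) (vs ! 0)" by (intro st; simp)+
    \<comment> \<open>At least one of the two steps is an arc; the other cannot be an arc back, nor
      an edge, which would change the kind.\<close>
    have "(vs ! 0, vs ! 1) \<in> A \<or> (vs ! 1, vs ! 0) \<in> A"
      using assms 2 by (simp add: is_cycle_def)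
    with s show False
      using no_arc_arc_2cycle arc_kind adj_kind unfolding step_iff by blast
  next
    case 3
    then have "step G (vs ! 0) (vs ! 1)" "step G (vs ! 1) (vs ! 2)" "step G (vs ! 2) (vs ! 0)"
      by (intro st; simp)+
    then show False using step_colour by blast
  next
    case 4
    then have "step G (vs ! 0) (vs ! 1)" "step G (vs ! 1) (vs ! 2)" "step G (vs ! 2) (vs ! 3)"
      "step G (vs ! 3) (vs ! 0)"
      by (intro st; simp)+
    then have "vs ! 0 = vs ! 2 \<or> vs ! 1 = vs ! 3" by (rule step_4walk)
    then show False using 4 dist by (simp add: nth_eq_iff_index_eq)
  next
    case 5
    then have "step G (vs ! 0) (vs ! 1)" "step G (vs ! 1) (vs ! 2)" "step G (vs ! 2) (vs ! 3)"
      "step G (vs ! 3) (vs ! 4)" "step G (vs ! 4) (vs ! 0)"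
      by (intro st; simp)+
    then show False using step_colour by blast
  qed
qed

text \<open>A triangle in copy 0: three vertices of one kind with their three joining vertices of
  the other. The incidences hold over the integers, and the coordinates 0, 1, 2 are residues because
  q is at least 3.\<close>

lemma hexagon: "is_cycle G [(False, False, 0, 0), (True, False, 0, 0), (False, False, 1, 0),
    (True, False, 2, 2), (False, False, 2, 2), (True, False, 1, 0)]"
  (is "is_cycle G ?vs")
proof -
  have V: "set ?vs \<subseteq> V" using q_ge_3 by (auto simp: V_def)
  have stepI: "step G (s, c, x, y) (t, c, m, b)"
    if "(s, c, x, y) \<in> V" "(t, c, m, b) \<in> V" "t = (\<not> s)" "y + b = x * m" for s t c x y m b
    using that by (simp add: step_iff adj_def)
  have "step G (False, False, 0, 0) (True, False, 0, 0)"
    "step G (True, False, 0, 0) (False, False, 1, 0)"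
    "step G (False, False, 1, 0) (True, False, 2, 2)"
    "step G (True, False, 2, 2) (False, False, 2, 2)"
    "step G (False, False, 2, 2) (True, False, 1, 0)"
    "step G (True, False, 1, 0) (False, False, 0, 0)"
    by (rule stepI; use V in simp)+
  then have "\<forall>i<length ?vs. step G (?vs ! i) (?vs ! (Suc i mod length ?vs))"
    by (simp add: All_less_Suc)
  then show ?thesis using V by (simp add: is_cycle_def)
qed

lemma girth_G: "girth G = 6"
proof (rule antisym)
  show "girth G \<le> 6"
    unfolding girth_def using hexagon
    by (intro Inf_lower) (force simp: numeral_eq_enat)
  show "6 \<le> girth G"
    unfolding girth_def using cycle_length_ge_6
    by (intro Inf_greatest) (auto simp: numeral_eq_enat)
qed

section \<open>Degrees, simplicity and order\<close>

lemma card_shifts: "card (shifts c) = nat h"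
  by (simp add: shifts_def)

text \<open>The sign \<open>k\<close> is 1 when counting out-arcs and -1 when counting in-arcs.
  Injectivity holds because each set of shifts is an interval shorter than \<open>q\<close>.\<close>

lemma inj_on_shifts:
  assumes "k = 1 \<or> k = - 1"
  shows "inj_on (\<lambda>d. (y + k * d) mod q) (shifts c)"
proof (rule inj_onI)
  fix d d' assume d: "d \<in> shifts c" "d' \<in> shifts c" and "(y + k * d) mod q = (y + k * d') mod q"
  then have "q dvd k * (d - d')" by (simp add: mod_eq_dvd_iff algebra_simps)
  then have "q dvd d - d'" using assms by (auto simp: dvd_diff_commute)
  moreover have "\<bar>d - d'\<bar> < q" using d q_def h_pos by (auto simp: shifts_def split: if_splits)
  ultimately show "d = d'" using dvd_imp_eq_0 by fastforce
qed

lemma card_out_arcs: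
  assumes "v \<in> V"
  shows "card {a \<in> A. fst a = v} = nat h"
proof -
  obtain s c x y where v: "v = (s, c, x, y)" "x \<in> {0..<q}" "y \<in> {0..<q}"
    using assms by (auto simp: V_def)
  let ?f = "\<lambda>d. (v, (s, \<not> c, x, (y + 1 * d) mod q))"
  have "{a \<in> A. fst a = v} = ?f ` shifts c"
  proof (intro subset_antisym subsetI)
    fix a assume "a \<in> {a \<in> A. fst a = v}"
    then obtain z d where "a = (v, (s, \<not> c, x, z))" "z \<in> {0..<q}" "d \<in> shifts c" "q dvd z - y - d"
      using v by (cases a) (auto elim!: arcE)
    moreover from this have "z = (y + 1 * d) mod q"
      by (intro mod_unique_residue) (auto simp: algebra_simps)
    ultimately show "a \<in> ?f ` shifts c" by blast
  next
    fix a assume "a \<in> ?f ` shifts c"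
    then obtain d where "d \<in> shifts c" "a = ?f d" by blast
    moreover have "q dvd (y + d) mod q - y - d"
      by (metis diff_diff_eq mod_eq_dvd_iff mod_mod_trivial)
    ultimately show "a \<in> {a \<in> A. fst a = v}"
      using v q_ge_3 by (auto simp: A_def)
  qed
  moreover have "inj_on ?f (shifts c)"
    using inj_on_shifts[of 1 y c] by (simp add: inj_on_def)
  ultimately show ?thesis by (simp only: card_image card_shifts)
qed

lemma card_in_arcs:
  assumes "v \<in> V"
  shows "card {a \<in> A. snd a = v} = nat h"
proof -
  obtain s c x y where v: "v = (s, c, x, y)" "x \<in> {0..<q}" "y \<in> {0..<q}"
    using assms by (auto simp: V_def)
  let ?f = "\<lambda>d. ((s, \<not> c, x, (y + -1 * d) mod q), v)"
  \<comment> \<open>Arcs into copy \<open>c\<close> start in the other copy, so the shifts of that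
    copy count.\<close>
  have "{a \<in> A. snd a = v} = ?f ` shifts (\<not> c)"
  proof (intro subset_antisym subsetI)
    fix a assume "a \<in> {a \<in> A. snd a = v}"
    then obtain u where a: "a = (u, v)" "(u, v) \<in> A" by (cases a) auto
    from a(2) obtain s' c' x' z y' d where "u = (s', c', x', z)" "v = (s', \<not> c', x', y')"
      "z \<in> {0..<q}" "d \<in> shifts c'" "q dvd y' - z - d" by (rule arcE)
    then have "a = ((s, \<not> c, x, z), v)" "z \<in> {0..<q}" "d \<in> shifts (\<not> c)" "q dvd y - z - d"
      using v a(1) by auto
    moreover from this have "q dvd - (y - z - d)" by (simp only: dvd_minus_iff)
    then have "z = (y + -1 * d) mod q"
      using calculation(2) by (intro mod_unique_residue) (simp_all add: algebra_simps)
    ultimately show "a \<in> ?f ` shifts (\<not> c)" by blast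
  next
    fix a assume "a \<in> ?f ` shifts (\<not> c)"
    then obtain d where "d \<in> shifts (\<not> c)" "a = ?f d" by blast
    moreover have "q dvd y - (y - d) mod q - d"
      using dvd_minus_mod[of q "y - d"] by (simp add: algebra_simps)
    ultimately show "a \<in> {a \<in> A. snd a = v}"
      using v q_ge_3 by (cases c) (simp_all add: A_def, blast+)
  qed
  moreover have "inj_on ?f (shifts (\<not> c))"
    using inj_on_shifts[of "-1" y "\<not> c"] by (simp add: inj_on_def)
  ultimately show ?thesis by (simp only: card_image card_shifts)
qed

text \<open>For each of the \<open>q\<close> values of the first coordinate \<open>m\<close>, the
  incidence equation has exactly one solution for the second coordinate of the neighbour.\<close>

lemma card_incident_edges:
  assumes "v \<in> V"
  shows "card {e \<in> edges G. v \<in> e} = nat q"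
proof -
  obtain s c x y where v: "v = (s, c, x, y)" "x \<in> {0..<q}" "y \<in> {0..<q}"
    using assms by (auto simp: V_def)
  let ?w = "\<lambda>m. (\<not> s, c, m, (x * m - y) mod q)"
  have "{e \<in> edges G. v \<in> e} = {{v, w} | w. adj v w}"
  proof (intro subset_antisym subsetI)
    fix e assume "e \<in> {e \<in> edges G. v \<in> e}"
    then obtain u w where e: "e = {u, w}" "adj u w" "v = u \<or> v = w" unfolding G_sel by blast
    from e(3) show "e \<in> {{v, w} | w. adj v w}"
    proof
      assume "v = u"
      then show ?thesis using e by blast
    next
      assume "v = w"
      then have "e = {v, u}" "adj v u" using e adj_sym by (simp_all only: insert_commute[of u])
      then show ?thesis by blast
    qed
  next
    fix e assume "e \<in> {{v, w} | w. adj v w}"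
    then obtain w where "e = {v, w}" "adj v w" by blast
    then have "e \<in> edges G" "v \<in> e" by (simp_all only: edge_iff_adj insertI1)
    then show "e \<in> {e \<in> edges G. v \<in> e}" by blast
  qed
  also have "\<dots> = (\<lambda>m. {v, ?w m}) ` {0..<q}"
  proof (intro subset_antisym subsetI)
    fix e assume "e \<in> {{v, w} | w. adj v w}"
    then obtain m b where "e = {v, (\<not> s, c, m, b)}" "m \<in> {0..<q}" "b \<in> {0..<q}" "q dvd y + b - x * m"
      using v by (auto elim!: adjE)
    moreover from this have "b = (x * m - y) mod q"
      by (intro mod_unique_residue) (auto simp: algebra_simps)
    ultimately show "e \<in> (\<lambda>m. {v, ?w m}) ` {0..<q}" by blast
  next
    fix e assume "e \<in> (\<lambda>m. {v, ?w m}) ` {0..<q}"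
    then obtain m where m: "m \<in> {0..<q}" "e = {v, ?w m}" by blast
    have "q dvd (x * m - y) mod q - (x * m - y)"
      by (metis mod_eq_dvd_iff mod_mod_trivial)
    then have "q dvd y + (x * m - y) mod q - x * m" by (simp add: algebra_simps)
    then have "adj v (?w m)"
      using v m(1) q_ge_3 by (auto simp: adj_def V_def)
    then show "e \<in> {{v, w} | w. adj v w}" using m(2) by blast
  qed
  also have "card \<dots> = nat q"
    by (subst card_image) (auto simp: inj_on_def doubleton_eq_iff v)
  finally show ?thesis .
qed

lemma simple_G: "simple_mixed_graph G"
  unfolding simple_mixed_graph_def
proof (intro conjI ballI)
  show "finite (verts G)" by (simp add: V_def)
  fix e assume "e \<in> edges G"
  then obtain u v where "e = {u, v}" "adj u v" by auto
  then show "e \<subseteq> verts G" "card e = 2"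
    using adj_kind[of u v] by (auto simp: adj_def)
next
  fix a assume a: "a \<in> arcs G"
  then obtain u v where uv: "a = (u, v)" "(u, v) \<in> A" by (cases a) auto
  then have "u \<in> V" "v \<in> V" "u \<noteq> v" by (auto elim!: arcE simp: V_def)
  moreover have "\<not> adj u v" using uv arc_kind adj_kind by blast
  ultimately show "case a of (u, v) \<Rightarrow> u \<in> verts G \<and> v \<in> verts G \<and> u \<noteq> v \<and> {u, v} \<notin> edges G"
    unfolding uv(1) prod.case edge_iff_adj by simp
qed

lemma zrg_G: "zrg_mixed_graph (nat h) (nat q) 6 G"
  unfolding zrg_mixed_graph_def
  using simple_G card_in_arcs card_out_arcs card_incident_edges girth_G
  by (simp only: G_sel(1,3)) (simp add: numeral_eq_enat)

lemma card_V: "card V = 4 * (nat q)\<^sup>2"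
  by (simp add: V_def card_cartesian_product power2_eq_square)

end

theorem corollary6:
  fixes q p :: nat
  assumes "prime q" and "q \<ge> 3" and "p = (q - 1) div 2" and "odd p"
  shows "min_order ((p + 1) div 2) q 6 \<le> enat (4 * q\<^sup>2)"
proof -
  have "odd q" using assms(1,2) prime_odd_nat by auto
  \<comment> \<open>Both halvings are exact: q odd gives q = 2 p + 1, and p odd makes p + 1
    even.\<close>
  then have "q + 1 = 4 * ((p + 1) div 2)"
    using assms(3,4) by (auto elim!: oddE)
  then have q: "int q = 4 * int ((p + 1) div 2) - 1" by linarith
  have prime: "prime (int q)" using assms(1) by simp
  then interpret biaffine "int ((p + 1) div 2)" "int q"
    by unfold_locales (rule q, rule prime)
  show ?thesis
    using min_order_le[OF zrg_G] unfolding G_sel(1) card_V nat_int .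
qed

end
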